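(* Let $G$ be a finite simple graph, let $v\in V(G)$ and let $B\subseteq V(G)$. Then: (i) if $v\in B$, then $$C_B(G;x)=C_{B\setminus\{v\}}(G-v;x)+x\,C_{B\cap N(v)}(G[N(v)];x);$$ (ii) if $v\notin B$, then $$C_B(G;x)=C_B(G-v;x).$$
   Context: For a finite simple graph $G$ and a subset $B\subseteq V(G)$, the $B$-restricted clique polynomial is $C_B(G;x)=\sum_{i=0}^{\omega(G[B])} c_i(B)x^i$, where $c_i(B)$ is the number of subsets $K\subseteq B$ with $|K|=i$ that are cliques in $G$ (pairwise adjacent vertices); the empty set counts as a clique, so $c_0(B)=1$. Here $G[S]$ is the subgraph of $G$ induced by $S$, $\omega$ is the clique number, $N(v)$ is the (open) neighbourhood of $v$ in $G$, and $G-v$ is the graph obtained by deleting the vertex $v$. *)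

theory Defs
  imports "HOL-Computational_Algebra.Polynomial" "Graph_Theory.Digraph_Component"
begin

text \<open>
  Finite simple graphs are the locale \<^locale>\<open>graph\<close>: finite, loop-free, symmetric digraphs without
  parallel arcs. Each undirected edge is a pair of opposite arcs, and \<open>u \<rightarrow>\<^bsub>G\<^esub> w\<close>
  says that \<open>u\<close> and \<open>w\<close> are adjacent. \<open>G \<restriction> S\<close> is the subgraph induced by \<open>S\<close>, and
  \<open>pre_digraph.del_vert G v\<close> is \<open>G - v\<close>.
\<close>

definition neighbourhood :: "('a, 'b) pre_digraph \<Rightarrow> 'a \<Rightarrow> 'a set" where
  "neighbourhood G v = {u \<in> verts G. v \<rightarrow>\<^bsub>G\<^esub> u}"

definition clique :: "('a, 'b) pre_digraph \<Rightarrow> 'a set \<Rightarrow> bool" where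
  "clique G K \<longleftrightarrow> K \<subseteq> verts G \<and> (\<forall>u\<in>K. \<forall>w\<in>K. u \<noteq> w \<longrightarrow> u \<rightarrow>\<^bsub>G\<^esub> w)"

definition clique_number :: "('a, 'b) pre_digraph \<Rightarrow> nat" where
  "clique_number G = Max (card ` {K. clique G K})"

definition clique_count :: "('a, 'b) pre_digraph \<Rightarrow> 'a set \<Rightarrow> nat \<Rightarrow> nat" where
  "clique_count G B i = card {K. K \<subseteq> B \<and> card K = i \<and> clique G K}"

text \<open>Meaningful only for \<open>B \<subseteq> verts G\<close>: \<open>G \<restriction> B\<close> has vertex set \<open>B\<close> whether or not \<open>B \<subseteq> verts G\<close>.\<close>

definition clique_poly :: "('a, 'b) pre_digraph \<Rightarrow> 'a set \<Rightarrow> int poly" where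
  "clique_poly G B = (\<Sum>i\<le>clique_number (G \<restriction> B). monom (int (clique_count G B i)) i)"

end

theory Submission
  imports Defs
begin

text \<open>
  The restricted clique polynomial is the sum of \<open>x ^ card K\<close> over all cliques \<open>K \<subseteq> B\<close>. The cliques
  avoiding \<open>v\<close> are those of \<open>G - v\<close>, and removing \<open>v\<close> from the cliques containing it is a
  bijection onto the cliques inside the neighbourhood of \<open>v\<close> that lowers the exponent by one.
\<close>

lemma dominates_induce_subgraph_iff:
  "u \<rightarrow>\<^bsub>G \<restriction> S\<^esub> w \<longleftrightarrow> u \<in> S \<and> w \<in> S \<and> u \<rightarrow>\<^bsub>G\<^esub> w"
  by (auto simp: arcs_ends_def arc_to_ends_def induce_subgraph_def)

lemma dominates_del_vert_iff:
  "u \<rightarrow>\<^bsub>pre_digraph.del_vert G v\<^esub> w \<longleftrightarrow> u \<noteq> v \<and> w \<noteq> v \<and> u \<rightarrow>\<^bsub>G\<^esub> w"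
  by (auto simp: arcs_ends_def arc_to_ends_def pre_digraph.del_vert_def)

lemma clique_induce_subgraph_iff:
  assumes "S \<subseteq> verts G"
  shows "clique (G \<restriction> S) K \<longleftrightarrow> K \<subseteq> S \<and> clique G K"
  using assms by (auto simp: clique_def dominates_induce_subgraph_iff)

lemma clique_del_vert_iff:
  "clique (pre_digraph.del_vert G v) K \<longleftrightarrow> v \<notin> K \<and> clique G K"
  by (auto simp: clique_def dominates_del_vert_iff pre_digraph.verts_del_vert)

text \<open>Grouping the cliques by cardinality gives the coefficients back. In this form an
  identity between polynomials becomes a decomposition of a set of cliques, with no comparison of
  the clique numbers of different graphs.\<close>

lemma clique_poly_eq_sum_cliques:
  assumes "finite B" and "B \<subseteq> verts G"
  shows "clique_poly G B = (\<Sum>K | K \<subseteq> B \<and> clique G K. monom 1 (card K))"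
proof -
  let ?C = "{K. K \<subseteq> B \<and> clique G K}"
  have fin: "finite ?C"
    using assms(1) by (auto intro: finite_subset[of _ "Pow B"])
  have num: "clique_number (G \<restriction> B) = Max (card ` ?C)"
    using assms(2) by (simp add: clique_number_def clique_induce_subgraph_iff)
  have "(\<Sum>K\<in>?C. monom (1::int) (card K))
      = (\<Sum>i\<le>clique_number (G \<restriction> B). \<Sum>K | K \<in> ?C \<and> card K = i. monom 1 (card K))"
    \<comment> \<open>No clique is lost by the truncation: the clique number is the maximum of the
      cardinalities over \<open>?C\<close>, so it bounds each of them.\<close>
    using fin by (intro sum.group[symmetric]) (auto simp: num)
  also have "\<dots> = clique_poly G B"
    unfolding clique_poly_def
  proof (intro sum.cong refl)
    fix i
    have "(\<Sum>K | K \<in> ?C \<and> card K = i. monom (1::int) (card K))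
        = (\<Sum>K | K \<in> ?C \<and> card K = i. monom 1 i)"
      by (intro sum.cong) auto
    also have "\<dots> = monom (int (clique_count G B i)) i"
      \<comment> \<open>The constant sum is a natural number times \<open>monom 1 i\<close>; read as
        a monomial of degree 0, that number merges into the coefficient.\<close>
      by (simp add: clique_count_def of_nat_monom mult_monom conj_ac)
    finally show "(\<Sum>K | K \<in> ?C \<and> card K = i. monom (1::int) (card K))
        = monom (int (clique_count G B i)) i" .
  qed
  finally show ?thesis by simp
qed

text \<open>Besides the pairs inside \<open>K\<close>, only those joining \<open>v\<close> to
  \<open>K\<close> matter. \<open>neighbourhood\<close> records the arcs leaving \<open>v\<close>;
  symmetry of \<open>G\<close> supplies the opposite ones.\<close>

lemma (in graph) clique_insert_iff:
  assumes "v \<in> verts G" and "v \<notin> K"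
  shows "clique G (insert v K) \<longleftrightarrow> K \<subseteq> neighbourhood G v \<and> clique G K"
  using assms sym_arcs by (auto simp: clique_def neighbourhood_def symmetric_def elim: symE)

lemma (in graph) neighbourhood_subset_verts: "neighbourhood G v \<subseteq> verts G"
  by (auto simp: neighbourhood_def)

lemma (in graph) not_in_neighbourhood: "v \<notin> neighbourhood G v"
  using adj_not_same by (auto simp: neighbourhood_def)

text \<open>Serves both cases of the theorem: with \<open>B\<close> itself if \<open>v\<close> lies
  outside \<open>B\<close>, and with \<open>B - {v}\<close> otherwise.\<close>

lemma (in graph) clique_poly_del_vert_notin:
  assumes "B \<subseteq> verts G" and "v \<notin> B"
  shows "clique_poly (pre_digraph.del_vert G v) B
    = (\<Sum>K | K \<subseteq> B \<and> clique G K. monom 1 (card K))"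
proof -
  have "finite B" "B \<subseteq> verts (pre_digraph.del_vert G v)"
    using assms finite_subset[OF assms(1)] by (auto simp: pre_digraph.verts_del_vert)
  then have "clique_poly (pre_digraph.del_vert G v) B
    = (\<Sum>K | K \<subseteq> B \<and> clique (pre_digraph.del_vert G v) K. monom 1 (card K))"
    by (rule clique_poly_eq_sum_cliques)
  also have "{K. K \<subseteq> B \<and> clique (pre_digraph.del_vert G v) K} = {K. K \<subseteq> B \<and> clique G K}"
    using assms(2) by (auto simp: clique_del_vert_iff)
  finally show ?thesis .
qed

lemma (in graph) clique_poly_vertex_recurrence:
  assumes "v \<in> B" and "B \<subseteq> verts G"
  shows "clique_poly G B = clique_poly (pre_digraph.del_vert G v) (B - {v})
    + [:0, 1:] * clique_poly (G \<restriction> neighbourhood G v) (B \<inter> neighbourhood G v)"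
proof -
  let ?N = "neighbourhood G v"
  let ?A = "{K. K \<subseteq> B - {v} \<and> clique G K}"
  let ?L = "{K. K \<subseteq> B \<inter> ?N \<and> clique G K}"
  have v: "v \<in> verts G" using assms by blast
  have finB: "finite B" using assms(2) finite_verts by (rule finite_subset)
  \<comment> \<open>Since \<open>G\<close> has no loops, \<open>v\<close> is not its own neighbour.
    Both facts are what \<open>card (insert v K) = Suc (card K)\<close> requires.\<close>
  have notin: "v \<notin> K" "finite K" if "K \<in> ?L" for K
    using that not_in_neighbourhood finB by (auto intro: finite_subset)
  have split: "{K. K \<subseteq> B \<and> clique G K} = ?A \<union> insert v ` ?L"
  proof (intro equalityI subsetI)
    fix K assume K: "K \<in> {K. K \<subseteq> B \<and> clique G K}"
    show "K \<in> ?A \<union> insert v ` ?L"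
    proof (cases "v \<in> K")
      case True
      then have "K = insert v (K - {v})" by blast
      moreover from this have "K - {v} \<in> ?L"
        using K clique_insert_iff[OF v, of "K - {v}"] by auto
      ultimately show ?thesis by blast
    qed (use K in auto)
  next
    fix K assume "K \<in> ?A \<union> insert v ` ?L"
    then show "K \<in> {K. K \<subseteq> B \<and> clique G K}"
      using assms(1) notin clique_insert_iff[OF v] by auto
  qed
  have inj: "inj_on (insert v) ?L"
    using notin by (intro inj_onI) (metis insert_ident)
  \<comment> \<open>The two families are disjoint, as membership of \<open>v\<close> tells them
    apart.\<close>
  have "clique_poly G B = (\<Sum>K\<in>?A. monom 1 (card K)) + (\<Sum>K\<in>insert v ` ?L. monom 1 (card K))"
    unfolding clique_poly_eq_sum_cliques[OF finB assms(2)] split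
    using finB by (intro sum.union_disjoint) auto
  also have "(\<Sum>K\<in>?A. monom 1 (card K)) = clique_poly (pre_digraph.del_vert G v) (B - {v})"
    using assms(2) by (intro clique_poly_del_vert_notin[symmetric]) auto
  \<comment> \<open>The vertex \<open>v\<close> adds one to each cardinality, which is the factor
    \<open>[:0, 1:]\<close>, that is, x.\<close>
  also have "(\<Sum>K\<in>insert v ` ?L. monom (1::int) (card K))
      = (\<Sum>K\<in>?L. [:0, 1:] * monom 1 (card K))"
    unfolding sum.reindex[OF inj] comp_def using notin
    by (intro sum.cong) (auto simp: monom_Suc)
  also have "\<dots> = [:0, 1:] * (\<Sum>K\<in>?L. monom 1 (card K))"
    by (rule sum_distrib_left[symmetric])
  \<comment> \<open>Every member of \<open>?L\<close> lies inside \<open>?N\<close>, so passing to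
    the induced subgraph changes no clique.\<close>
  also have "?L = {K. K \<subseteq> B \<inter> ?N \<and> clique (G \<restriction> ?N) K}"
    using clique_induce_subgraph_iff[OF neighbourhood_subset_verts] by auto
  also have "(\<Sum>K\<in>\<dots>. monom 1 (card K)) = clique_poly (G \<restriction> ?N) (B \<inter> ?N)"
    using finB by (intro clique_poly_eq_sum_cliques[symmetric]) auto
  finally show ?thesis .
qed

theorem lemma2p1:
  fixes G :: "('a, 'b) pre_digraph" and v :: 'a and B :: "'a set"
  assumes "graph G" and "v \<in> verts G" and "B \<subseteq> verts G"
  shows "(v \<in> B \<longrightarrow>
            clique_poly G B =
              clique_poly (pre_digraph.del_vert G v) (B - {v})
              + [:0, 1:] * clique_poly (G \<restriction> neighbourhood G v) (B \<inter> neighbourhood G v))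
       \<and> (v \<notin> B \<longrightarrow> clique_poly G B = clique_poly (pre_digraph.del_vert G v) B)"
proof -
  interpret graph G by fact
  have "finite B" using assms(3) finite_verts by (rule finite_subset)
  then have "clique_poly G B = clique_poly (pre_digraph.del_vert G v) B" if "v \<notin> B"
    using that assms(3) by (simp add: clique_poly_del_vert_notin clique_poly_eq_sum_cliques)
  then show ?thesis
    using assms(3) clique_poly_vertex_recurrence by blast
qed

end
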